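(* Let $f:\mathbb{R}^d\to\mathbb{R}$ be differentiable and $\mu$-strongly convex with $\mu>0$; let $x^\star$ be its minimizer and $f^\star:=f(x^\star)$. Suppose $f$ is matrix smooth with matrix $\mathbb{L}$, $L:=\|\mathbb{L}\|$, and the sketch moment conditions hold with constants $\omega,\ell>0$ (as in the context). Let $\{x_k,y_k,z_k\}$ be generated by algorithm RS-NAG-SC (as in the context), with $\theta=\sqrt{\mu/(L\omega\ell)}\in(0,1]$, and let $$\Phi_k^{\mathrm{SC}}:=f(x_k)-f^\star+\frac\mu2\|z_k-x^\star\|^2,\qquad \rho:=1-\theta.$$ If $\rho=0$, then almost surely $\Phi_k^{\mathrm{SC}}=0$ for all $k\ge1$. Consequently, for every $\eta\in(0,1)$, with probability one, $f(x_0)-f^\star\le\Phi_0^{\mathrm{SC}}/\eta$ and $f(x_k)-f^\star=0$ for all $k\ge1$; and for every $q\in(0,1)$, almost surely, $f(x_k)-f^\star\le\Phi_0^{\mathrm{SC}}q^k$ for all $k\ge1$. If $\rho\in(0,1)$, then: (i) For every $\eta\in(0,1)$, with probability at least $1-\eta$, $$f(x_k)-f^\star\le\frac{\Phi_0^{\mathrm{SC}}}{\eta}\rho^k\quad\text{for all }k\ge0.$$ (ii) For every $q\in(\rho,1)$, almost surely there exists a finite random integer $K_q$ such that for all $k\ge K_q$, $$f(x_k)-f^\star\le\Phi_0^{\mathrm{SC}}\,q^k.$$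
   Context: Standing assumptions: $d\ge2$, $1\le r\le d$. $\|\cdot\|$ is the Euclidean norm for vectors and the induced operator norm for matrices; $A\preceq B$ means $B-A$ is positive semidefinite. Matrix smoothness: there is a fixed symmetric matrix $\mathbb{L}\in\mathbb{R}^{d\times d}$, $\mathbb{L}\succeq0$, $\mathbb{L}\ne0$, such that for all $x,y\in\mathbb{R}^d$, $f(y)\le f(x)+\langle\nabla f(x),y-x\rangle+\tfrac12(y-x)^\top\mathbb{L}(y-x)$. Put $L:=\|\mathbb{L}\|$. Sketch moment conditions: $P\in\mathbb{R}^{d\times r}$ is a random matrix (the expectations below being finite) and $\omega>0,\ell>0$ are constants with $\mathbb{E}[PP^\top]=I_d$, $\mathbb{E}[(PP^\top)^2]\preceq\omega I_d$, $\mathbb{E}[PP^\top\mathbb{L}PP^\top]\preceq\ell L\,I_d$. (These hypotheses imply $\theta\in(0,1]$.) Algorithm RS-NAG-SC: given deterministic $x_0\in\mathbb{R}^d$ and i.i.d. copies $P_k$ of $P$, set $\theta=\sqrt{\mu/(L\omega\ell)}$, $z_0=x_0$, and for $k=0,1,2,\dots$: $y_k=\dfrac1{1+\theta}x_k+\dfrac{\theta}{1+\theta}z_k$, $x_{k+1}=y_k-\dfrac1{L\ell}P_kP_k^\top\nabla f(y_k)$, $z_{k+1}=(1-\theta)z_k+\theta y_k-\dfrac{\theta}{\mu}P_kP_k^\top\nabla f(y_k)$. *)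

theory Defs
  imports "HOL-Probability.Probability"
begin

text \<open>A matrix in \<open>\<real>\<^sup>m\<^sup>\<times>\<^sup>n\<close> (\<open>m\<close> rows, \<open>n\<close> columns) has type
  \<open>real ^ 'n ^ 'm\<close>.\<close>

definition psd :: "real ^ 'n ^ 'n \<Rightarrow> bool" where
  "psd A \<longleftrightarrow> transpose A = A \<and> (\<forall>v. 0 \<le> v \<bullet> (A *v v))"

definition loewner_le :: "real ^ 'n ^ 'n \<Rightarrow> real ^ 'n ^ 'n \<Rightarrow> bool" (infix "\<preceq>" 50) where
  "A \<preceq> B \<longleftrightarrow> psd (B - A)"

definition op_norm :: "real ^ 'n ^ 'm \<Rightarrow> real" where
  "op_norm A = onorm ((*v) A)"

text \<open>Meaningful only where \<open>f\<close> is differentiable.\<close>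

definition grad :: "('a::real_inner \<Rightarrow> real) \<Rightarrow> 'a \<Rightarrow> 'a" where
  "grad f x = (THE D. GDERIV f x :> D)"

definition strongly_convex :: "real \<Rightarrow> ('a::real_inner \<Rightarrow> real) \<Rightarrow> bool" where
  "strongly_convex \<mu> f \<longleftrightarrow>
     (\<forall>x y. \<forall>t\<in>{0..1}. f ((1 - t) *\<^sub>R x + t *\<^sub>R y)
        \<le> (1 - t) * f x + t * f y - \<mu> / 2 * t * (1 - t) * (norm (x - y))\<^sup>2)"

definition matrix_smooth :: "real ^ 'd ^ 'd \<Rightarrow> (real ^ 'd \<Rightarrow> real) \<Rightarrow> bool" where
  "matrix_smooth LL f \<longleftrightarrow>
     (\<forall>x y. f y \<le> f x + grad f x \<bullet> (y - x) + 1 / 2 * ((y - x) \<bullet> (LL *v (y - x))))"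

definition sketch_moments ::
  "'v measure \<Rightarrow> ('v \<Rightarrow> real ^ 'r ^ 'd) \<Rightarrow> real ^ 'd ^ 'd \<Rightarrow> real \<Rightarrow> real \<Rightarrow> bool" where
  "sketch_moments N P LL \<omega> ell \<longleftrightarrow>
     (let S = (\<lambda>v. P v ** transpose (P v)) in
       integrable N S \<and>
       integrable N (\<lambda>v. S v ** S v) \<and>
       integrable N (\<lambda>v. S v ** LL ** S v) \<and>
       (\<integral>v. S v \<partial>N) = mat 1 \<and>
       (\<integral>v. S v ** S v \<partial>N) \<preceq> \<omega> *\<^sub>R mat 1 \<and>
       (\<integral>v. S v ** LL ** S v \<partial>N) \<preceq> (ell * op_norm LL) *\<^sub>R mat 1)"

text \<open>One realisation of the algorithm: \<open>Pk\<close> is the sequence of sampled sketches, and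
  \<open>x\<close>, \<open>y\<close>, \<open>z\<close> are the resulting iterates.\<close>

definition rs_nag_sc ::
  "(real ^ 'd \<Rightarrow> real) \<Rightarrow> real \<Rightarrow> real \<Rightarrow> real \<Rightarrow> real \<Rightarrow> real ^ 'd \<Rightarrow> (nat \<Rightarrow> real ^ 'r ^ 'd)
     \<Rightarrow> (nat \<Rightarrow> real ^ 'd) \<Rightarrow> (nat \<Rightarrow> real ^ 'd) \<Rightarrow> (nat \<Rightarrow> real ^ 'd) \<Rightarrow> bool" where
  "rs_nag_sc f \<mu> L ell \<theta> x0 Pk x y z \<longleftrightarrow>
     x 0 = x0 \<and> z 0 = x0 \<and>
     (\<forall>k. y k = (1 / (1 + \<theta>)) *\<^sub>R x k + (\<theta> / (1 + \<theta>)) *\<^sub>R z k \<and>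
          x (Suc k) = y k - (1 / (L * ell)) *\<^sub>R ((Pk k ** transpose (Pk k)) *v grad f (y k)) \<and>
          z (Suc k) = (1 - \<theta>) *\<^sub>R z k + \<theta> *\<^sub>R y k
                      - (\<theta> / \<mu>) *\<^sub>R ((Pk k ** transpose (Pk k)) *v grad f (y k)))"

definition potential_sc ::
  "('a::real_inner \<Rightarrow> real) \<Rightarrow> real \<Rightarrow> 'a \<Rightarrow> 'a \<Rightarrow> 'a \<Rightarrow> real" where
  "potential_sc f \<mu> xstar x z = f x - f xstar + \<mu> / 2 * (norm (z - xstar))\<^sup>2"

end

theory Submission
  imports Defs
begin

text \<open>
  For a fixed state, the sketch moments turn the quadratic terms of one step into multiples of
  \<open>\<parallel>\<nabla>f(y)\<parallel>\<^sup>2\<close>, and \<open>\<theta>\<^sup>2 = \<mu> / (L \<omega> \<ell>)\<close> is the choice for which these cancel; strong convexity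
  then bounds the remaining terms by \<open>\<rho>\<close> times the current potential. Since the next sketch is
  independent of the past, \<open>\<Phi>\<^sub>k / \<rho>\<^sup>k\<close> is a nonnegative supermartingale with a deterministic initial
  value. Ville's maximal inequality gives the bound uniform in \<open>k\<close>; Markov's inequality and the
  Borel--Cantelli lemma give the almost sure rate. When the initial potential or \<open>\<rho>\<close> vanishes, the
  potential has expectation zero and so vanishes almost surely.
\<close>

section \<open>Gradients: existence, measurability, strong convexity to first order\<close>

lemma GDERIV_unique:
  assumes "GDERIV f x :> D" "GDERIV f x :> E"
  shows "D = E"
proof -
  have "(\<lambda>h. h \<bullet> D) = (\<lambda>h. h \<bullet> E)"
    using assms unfolding gderiv_def by (rule has_derivative_unique)
  then show ?thesis
    by (metis inner_commute vector_eq_rdot)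
qed

text \<open>Since \<open>grad\<close> is a definite description, existence is needed as well as
  uniqueness. In finite dimension the values of the derivative on the basis are the coordinates of
  the gradient.\<close>

lemma GDERIV_grad:
  fixes f :: "'a::euclidean_space \<Rightarrow> real"
  assumes "f differentiable (at x)"
  shows "GDERIV f x :> grad f x"
proof -
  obtain f' where f': "(f has_derivative f') (at x)"
    using assms by (auto simp: differentiable_def)
  interpret f': linear f'
    using f' by (rule has_derivative_linear)
  have "f' h = h \<bullet> (\<Sum>b\<in>Basis. f' b *\<^sub>R b)" for h
  proof -
    have "f' h = f' (\<Sum>b\<in>Basis. (h \<bullet> b) *\<^sub>R b)"
      by (simp only: euclidean_representation)
    also have "\<dots> = (\<Sum>b\<in>Basis. (h \<bullet> b) * f' b)"
      by (simp only: f'.sum f'.scale real_scaleR_def)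
    finally show ?thesis
      by (simp add: inner_sum_right mult.commute)
  qed
  then have "f' = (\<lambda>h. h \<bullet> (\<Sum>b\<in>Basis. f' b *\<^sub>R b))"
    by blast
  with f' have "GDERIV f x :> (\<Sum>b\<in>Basis. f' b *\<^sub>R b)"
    by (simp add: gderiv_def)
  then show ?thesis
    unfolding grad_def by (rule theI) (rule GDERIV_unique[OF _ \<open>GDERIV f x :> _\<close>])
qed

text \<open>The steps \<open>1 / real (Suc n)\<close> make this a limit along a sequence, as needed
  both for measurability of the gradient and for passing to the limit in the strong convexity
  inequality.\<close>

lemma grad_directional_LIMSEQ:
  fixes f :: "'a::euclidean_space \<Rightarrow> real"
  assumes "f differentiable (at x)"
  shows "(\<lambda>n. real (Suc n) * (f (x + (1 / real (Suc n)) *\<^sub>R h) - f x)) \<longlonglongrightarrow> grad f x \<bullet> h"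
proof -
  have "(f has_derivative (\<lambda>h. h \<bullet> grad f x)) (at (x + 0 *\<^sub>R h))"
    using GDERIV_grad[OF assms] by (simp add: gderiv_def)
  moreover have "((\<lambda>t. x + t *\<^sub>R h) has_derivative (\<lambda>t. t *\<^sub>R h)) (at 0)"
    by (auto intro!: derivative_eq_intros)
  ultimately have "((\<lambda>t. f (x + t *\<^sub>R h)) has_derivative (\<lambda>t. (t *\<^sub>R h) \<bullet> grad f x)) (at 0)"
    by (rule has_derivative_compose[where g = f, rotated])
  then have "DERIV (\<lambda>t. f (x + t *\<^sub>R h)) 0 :> grad f x \<bullet> h"
    by (simp add: has_field_derivative_def inner_commute mult_commute_abs)
  then have "((\<lambda>t. (f (x + t *\<^sub>R h) - f x) / t) \<longlongrightarrow> grad f x \<bullet> h) (at 0)"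
    by (simp add: DERIV_def)
  moreover have "filterlim (\<lambda>n. 1 / real (Suc n)) (at 0) sequentially"
    using LIMSEQ_Suc[OF lim_1_over_n] by (simp add: filterlim_at)
  ultimately have "(\<lambda>n. (f (x + (1 / real (Suc n)) *\<^sub>R h) - f x) / (1 / real (Suc n))) \<longlonglongrightarrow> grad f x \<bullet> h"
    by (rule filterlim_compose)
  then show ?thesis
    by (simp add: mult.commute)
qed

text \<open>Each coordinate is a pointwise limit of difference quotients of the continuous function
  \<open>f\<close>. Measurability of the iterates rests on this.\<close>

lemma borel_measurable_grad:
  fixes f :: "'a::euclidean_space \<Rightarrow> real"
  assumes "\<And>x. f differentiable (at x)"
  shows "grad f \<in> borel_measurable borel"
proof -
  have "continuous_on UNIV f"
    using assms by (meson continuous_at_imp_continuous_on differentiable_imp_continuous_within)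
  then have [measurable]: "f \<in> borel_measurable borel"
    by (rule borel_measurable_continuous_onI)
  show ?thesis
  proof (rule borel_measurable_euclidean_space[THEN iffD2], rule ballI)
    fix b :: 'a
    show "(\<lambda>x. grad f x \<bullet> b) \<in> borel_measurable borel"
      by (rule borel_measurable_LIMSEQ_real[OF grad_directional_LIMSEQ[OF assms]]) measurable
  qed
qed

text \<open>Divide the defining inequality at \<open>t = 1 / real (Suc n)\<close> by
  \<open>t\<close> and let \<open>n\<close> tend to infinity; the factor \<open>1 - t\<close> on the
  quadratic term tends to 1.\<close>

lemma strongly_convex_grad:
  fixes f :: "'a::euclidean_space \<Rightarrow> real"
  assumes "f differentiable (at x)" "strongly_convex \<mu> f"
  shows "f x + grad f x \<bullet> (y - x) + \<mu> / 2 * (norm (y - x))\<^sup>2 \<le> f y"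
proof -
  define c where "c = \<mu> / 2 * (norm (y - x))\<^sup>2"
  have le: "real (Suc n) * (f (x + (1 / real (Suc n)) *\<^sub>R (y - x)) - f x)
      \<le> f y - f x - (1 - 1 / real (Suc n)) * c" for n
  proof -
    define t where "t = 1 / real (Suc n)"
    have t: "0 < t" "t \<le> 1" "real (Suc n) = 1 / t"
      by (auto simp: t_def)
    have "x + t *\<^sub>R (y - x) = (1 - t) *\<^sub>R x + t *\<^sub>R y"
      by (simp add: algebra_simps)
    moreover have "f ((1 - t) *\<^sub>R x + t *\<^sub>R y)
        \<le> (1 - t) * f x + t * f y - \<mu> / 2 * t * (1 - t) * (norm (x - y))\<^sup>2"
      using assms(2) t unfolding strongly_convex_def by auto
    ultimately have "f (x + t *\<^sub>R (y - x)) - f x \<le> t * (f y - f x - (1 - t) * c)"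
      by (simp add: c_def norm_minus_commute algebra_simps)
    then have "(f (x + t *\<^sub>R (y - x)) - f x) / t \<le> f y - f x - (1 - t) * c"
      using \<open>0 < t\<close> by (simp add: pos_divide_le_eq mult.commute)
    then show ?thesis
      unfolding t_def[symmetric] t(3) by simp
  qed
  have "(\<lambda>n. f y - f x - (1 - 1 / real (Suc n)) * c) \<longlonglongrightarrow> f y - f x - (1 - 0) * c"
    by (intro tendsto_intros LIMSEQ_Suc[OF lim_1_over_n])
  from LIMSEQ_le[OF grad_directional_LIMSEQ[OF assms(1), of "y - x"] this] le
  show ?thesis
    by (auto simp: c_def)
qed

section \<open>From matrix moments of the sketch to scalar expectations\<close>

lemma psd_le_scaleR_mat_1:
  assumes "A \<preceq> c *\<^sub>R mat 1"
  shows "g \<bullet> (A *v g) \<le> c * (g \<bullet> g)"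
proof -
  have "0 \<le> g \<bullet> ((c *\<^sub>R mat 1 - A) *v g)"
    using assms unfolding loewner_le_def psd_def by blast
  then show ?thesis
    by (simp add: matrix_vector_mult_diff_rdistrib inner_diff_right flip: scaleR_matrix_vector_assoc)
qed

text \<open>Bounded linear maps commute with the Bochner integral; this turns integrals of matrices
  into integrals of scalars.\<close>

lemma bounded_linear_quadratic:
  fixes a :: "real ^ 'm"
  shows "bounded_linear (\<lambda>A :: real ^ 'n ^ 'm. a \<bullet> (A *v g))"
proof (rule linear_conv_bounded_linear[THEN iffD1], rule linearI)
  show "a \<bullet> ((A + B) *v g) = a \<bullet> (A *v g) + a \<bullet> (B *v g)" for A B :: "real ^ 'n ^ 'm"
    by (simp add: matrix_vector_mult_add_rdistrib inner_add_right)
  show "a \<bullet> ((c *\<^sub>R A) *v g) = c *\<^sub>R (a \<bullet> (A *v g))" for c and A :: "real ^ 'n ^ 'm"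
    by (simp flip: scaleR_matrix_vector_assoc)
qed

lemma
  fixes a :: "real ^ 'm" and X :: "'v \<Rightarrow> real ^ 'n ^ 'm"
  assumes "integrable N X"
  shows integrable_quadratic: "integrable N (\<lambda>v. a \<bullet> (X v *v g))"
    and integral_quadratic: "(\<integral>v. a \<bullet> (X v *v g) \<partial>N) = a \<bullet> ((\<integral>v. X v \<partial>N) *v g)"
  using integrable_bounded_linear[OF bounded_linear_quadratic assms]
    integral_bounded_linear[OF bounded_linear_quadratic assms] by auto

text \<open>The matrix \<open>P v ** transpose (P v)\<close> is symmetric, so it can be moved across
  the inner product, and both quadratic forms in \<open>d v\<close> become forms in \<open>g\<close>
  to which the moment bounds apply. The vector \<open>a\<close> is kept general because it is used
  both as the gradient and as the offset of the \<open>z\<close>-update from the minimizer.\<close>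

lemma sketch_moments_vec:
  fixes P :: "'v \<Rightarrow> real ^ 'r ^ 'd" and g a :: "real ^ 'd"
  assumes "sketch_moments N P LL \<omega> ell"
  defines "d \<equiv> \<lambda>v. (P v ** transpose (P v)) *v g"
  shows "integrable N (\<lambda>v. a \<bullet> d v)" "(\<integral>v. a \<bullet> d v \<partial>N) = a \<bullet> g"
    "integrable N (\<lambda>v. d v \<bullet> d v)" "(\<integral>v. d v \<bullet> d v \<partial>N) \<le> \<omega> * (g \<bullet> g)"
    "integrable N (\<lambda>v. d v \<bullet> (LL *v d v))"
    "(\<integral>v. d v \<bullet> (LL *v d v) \<partial>N) \<le> ell * op_norm LL * (g \<bullet> g)"
proof -
  define S where "S = (\<lambda>v. P v ** transpose (P v))"
  have m: "integrable N S" "integrable N (\<lambda>v. S v ** S v)" "integrable N (\<lambda>v. S v ** LL ** S v)"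
    "(\<integral>v. S v \<partial>N) = mat 1" "(\<integral>v. S v ** S v \<partial>N) \<preceq> \<omega> *\<^sub>R mat 1"
    "(\<integral>v. S v ** LL ** S v \<partial>N) \<preceq> (ell * op_norm LL) *\<^sub>R mat 1"
    using assms(1) unfolding sketch_moments_def S_def Let_def by auto
  have d: "d v = S v *v g" for v
    by (simp add: d_def S_def)
  have sym: "(S v *v u) \<bullet> w = u \<bullet> (S v *v w)" for u w v
  proof -
    have "transpose (S v) = S v"
      by (simp add: S_def matrix_transpose_mul)
    then have "S v *v u = u v* S v"
      by (metis transpose_matrix_vector)
    then show ?thesis
      by (simp add: dot_lmul_matrix)
  qed
  have d2: "d v \<bullet> d v = g \<bullet> ((S v ** S v) *v g)"
    "d v \<bullet> (LL *v d v) = g \<bullet> ((S v ** LL ** S v) *v g)" for v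
    by (simp_all add: d sym matrix_vector_mul_assoc[symmetric] del: matrix_vector_mul_assoc)
  show "integrable N (\<lambda>v. a \<bullet> d v)" "(\<integral>v. a \<bullet> d v \<partial>N) = a \<bullet> g"
    using m(1,4) by (simp_all add: d integrable_quadratic integral_quadratic)
  show "integrable N (\<lambda>v. d v \<bullet> d v)" "(\<integral>v. d v \<bullet> d v \<partial>N) \<le> \<omega> * (g \<bullet> g)"
    using m(2,5) by (simp_all add: d2 integrable_quadratic integral_quadratic psd_le_scaleR_mat_1)
  show "integrable N (\<lambda>v. d v \<bullet> (LL *v d v))"
    "(\<integral>v. d v \<bullet> (LL *v d v) \<partial>N) \<le> ell * op_norm LL * (g \<bullet> g)"
    using m(3,6) by (simp_all add: d2 integrable_quadratic integral_quadratic psd_le_scaleR_mat_1)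
qed

section \<open>The algorithm as a recursion on states, and its measurability\<close>

definition nag_mid :: "real \<Rightarrow> 'a::real_vector \<times> 'a \<Rightarrow> 'a" where
  "nag_mid \<theta> s = (1 / (1 + \<theta>)) *\<^sub>R fst s + (\<theta> / (1 + \<theta>)) *\<^sub>R snd s"

text \<open>The pair of \<open>x\<close> and \<open>z\<close> is a full state because
  \<open>y\<close> is computed from it. A step is thus a function of the state and the next sketch,
  and the two can be integrated separately.\<close>

definition nag_step ::
  "(real ^ 'd \<Rightarrow> real) \<Rightarrow> real \<Rightarrow> real \<Rightarrow> real \<Rightarrow> real
     \<Rightarrow> (real ^ 'd) \<times> (real ^ 'd) \<Rightarrow> real ^ 'r ^ 'd \<Rightarrow> (real ^ 'd) \<times> (real ^ 'd)" where
  "nag_step f \<mu> L ell \<theta> s p =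
     (let y = nag_mid \<theta> s; d = (p ** transpose p) *v grad f y in
       (y - (1 / (L * ell)) *\<^sub>R d,
        (1 - \<theta>) *\<^sub>R snd s + \<theta> *\<^sub>R y - (\<theta> / \<mu>) *\<^sub>R d))"

primrec nag_state ::
  "(real ^ 'd \<Rightarrow> real) \<Rightarrow> real \<Rightarrow> real \<Rightarrow> real \<Rightarrow> real \<Rightarrow> real ^ 'd
     \<Rightarrow> (nat \<Rightarrow> real ^ 'r ^ 'd) \<Rightarrow> nat \<Rightarrow> (real ^ 'd) \<times> (real ^ 'd)" where
  "nag_state f \<mu> L ell \<theta> x0 p 0 = (x0, x0)"
| "nag_state f \<mu> L ell \<theta> x0 p (Suc k) = nag_step f \<mu> L ell \<theta> (nag_state f \<mu> L ell \<theta> x0 p k) (p k)"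

lemma rs_nag_sc_nag_state:
  assumes "rs_nag_sc f \<mu> L ell \<theta> x0 p x y z"
  shows "(x k, z k) = nag_state f \<mu> L ell \<theta> x0 p k"
proof (induction k)
  case 0
  then show ?case
    using assms by (simp add: rs_nag_sc_def)
next
  case (Suc k)
  have "y k = nag_mid \<theta> (x k, z k)"
    using assms unfolding rs_nag_sc_def nag_mid_def by auto
  then show ?case
    using assms unfolding nag_state.simps Suc[symmetric] rs_nag_sc_def nag_step_def Let_def by auto
qed

text \<open>Only the first \<open>k\<close> sketches enter the state at time \<open>k\<close>. Hence
  the recursion may be run on a finite history, whatever its values beyond \<open>k\<close>.\<close>

lemma nag_state_cong:
  "(\<And>i. i < k \<Longrightarrow> p i = q i) \<Longrightarrow> nag_state f \<mu> L ell \<theta> x0 p k = nag_state f \<mu> L ell \<theta> x0 q k"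
  by (induction k) auto

text \<open>Sketch and gradient enter only through the map sending \<open>(A, g)\<close> to
  \<open>(A ** transpose A) *v g\<close>, which is polynomial in the entries and so jointly
  continuous.\<close>

lemma borel_measurable_nag_step [measurable]:
  fixes f :: "real ^ 'd \<Rightarrow> real"
  assumes "\<And>x. f differentiable (at x)"
    and [measurable]: "s \<in> M \<rightarrow>\<^sub>M borel \<Otimes>\<^sub>M borel" "p \<in> borel_measurable M"
  shows "(\<lambda>w. nag_step f \<mu> L ell \<theta> (s w) (p w :: real ^ 'r ^ 'd)) \<in> M \<rightarrow>\<^sub>M borel \<Otimes>\<^sub>M borel"
proof -
  have [measurable]: "grad f \<in> borel_measurable borel"
    using assms(1) by (rule borel_measurable_grad)
  have y [measurable]: "(\<lambda>w. nag_mid \<theta> (s w)) \<in> borel_measurable M"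
    unfolding nag_mid_def by measurable
  have "continuous_on UNIV (\<lambda>(A, g). ((A :: real ^ 'r ^ 'd) ** transpose A) *v g)"
    unfolding matrix_vector_mult_def matrix_matrix_mult_def transpose_def case_prod_beta
    by (intro continuous_intros)
  then have "(\<lambda>(A, g). ((A :: real ^ 'r ^ 'd) ** transpose A) *v g) \<in> borel \<Otimes>\<^sub>M borel \<rightarrow>\<^sub>M borel"
    by (simp add: borel_prod borel_measurable_continuous_onI)
  then have [measurable]:
    "(\<lambda>w. (p w ** transpose (p w)) *v grad f (nag_mid \<theta> (s w))) \<in> borel_measurable M"
    using measurable_compose[OF measurable_Pair[of p M borel "\<lambda>w. grad f (nag_mid \<theta> (s w))" borel]]
      measurable_compose[OF y \<open>grad f \<in> _\<close>] assms(3) by fastforce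
  show ?thesis
    unfolding nag_step_def Let_def by measurable
qed

text \<open>Asking for measurability only at \<open>i < k\<close> lets this serve for the filtration
  and for the finite product space of histories as well as for the full space.\<close>

lemma borel_measurable_nag_state:
  fixes f :: "real ^ 'd \<Rightarrow> real" and p :: "nat \<Rightarrow> 'w \<Rightarrow> real ^ 'r ^ 'd"
  assumes "\<And>x. f differentiable (at x)" and "\<And>i. i < k \<Longrightarrow> p i \<in> borel_measurable M"
  shows "(\<lambda>w. nag_state f \<mu> L ell \<theta> x0 (\<lambda>i. p i w) k) \<in> M \<rightarrow>\<^sub>M borel \<Otimes>\<^sub>M borel"
  using assms(2) by (induction k) (auto intro!: borel_measurable_nag_step assms(1))

lemma borel_measurable_potential_sc:
  fixes f :: "real ^ 'd \<Rightarrow> real"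
  assumes "\<And>x. f differentiable (at x)"
  shows "(\<lambda>s. potential_sc f \<mu> xstar (fst s) (snd s)) \<in> borel_measurable (borel \<Otimes>\<^sub>M borel)"
proof -
  have "continuous_on UNIV f"
    using assms by (meson continuous_at_imp_continuous_on differentiable_imp_continuous_within)
  then have [measurable]: "f \<in> borel_measurable borel"
    by (rule borel_measurable_continuous_onI)
  show ?thesis
    unfolding potential_sc_def by measurable
qed

section \<open>Expected decrease of the potential in one step\<close>

lemma potential_sc_nonneg:
  assumes "is_arg_min f (\<lambda>_. True) xstar" "\<mu> > 0"
  shows "0 \<le> f x - f xstar" and "f x - f xstar \<le> potential_sc f \<mu> xstar x z"
    and "0 \<le> potential_sc f \<mu> xstar x z"
  using assms by (auto simp: is_arg_min_linorder potential_sc_def)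

text \<open>This is the deterministic remainder once the terms quadratic in the gradient have
  cancelled. The coupling gives \<open>x - y = \<theta> *\<^sub>R (y - z)\<close>, so
  \<open>\<theta> * (a \<bullet> g)\<close> splits into the linear terms of the convexity
  inequalities at \<open>x\<close> and at \<open>xstar\<close>, with weights
  \<open>1 - \<theta>\<close> and \<open>\<theta>\<close>.\<close>

lemma strongly_convex_mid_le:
  fixes f :: "real ^ 'd \<Rightarrow> real" and x z xstar :: "real ^ 'd"
  assumes "f differentiable (at y)" "strongly_convex \<mu> f" "0 \<le> \<mu>" "0 < \<theta>" "\<theta> \<le> 1"
    and y: "y = nag_mid \<theta> (x, z)"
  defines "a \<equiv> (1 - \<theta>) *\<^sub>R z + \<theta> *\<^sub>R y - xstar"
  shows "f y - f xstar + \<mu> / 2 * (a \<bullet> a) - \<theta> * (a \<bullet> grad f y)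
    \<le> (1 - \<theta>) * potential_sc f \<mu> xstar x z"
proof -
  define g where "g = grad f y"
  have "(1 + \<theta>) *\<^sub>R y = x + \<theta> *\<^sub>R z"
    using \<open>0 < \<theta>\<close> by (simp add: y nag_mid_def scaleR_add_right)
  then have x: "x = y + \<theta> *\<^sub>R (y - z)"
    by (simp add: algebra_simps)
  have ag: "\<theta> * (a \<bullet> g) = - (1 - \<theta>) * (g \<bullet> (x - y)) - \<theta> * (g \<bullet> (xstar - y))"
    unfolding a_def x by (simp add: algebra_simps inner_commute)
  \<comment> \<open>The identity for the squared norm of a convex combination, applied to
    \<open>z - xstar\<close> and \<open>y - xstar\<close>; its last term has a favourable
    sign.\<close>
  have aa: "a \<bullet> a = (1 - \<theta>) * (norm (z - xstar))\<^sup>2 + \<theta> * (norm (xstar - y))\<^sup>2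
      - \<theta> * (1 - \<theta>) * (norm (z - y))\<^sup>2"
    unfolding a_def power2_norm_eq_inner by (simp add: algebra_simps inner_commute)
  have "f y + g \<bullet> (x - y) \<le> f x"
    using strongly_convex_grad[OF assms(1,2), of x] \<open>0 \<le> \<mu>\<close> unfolding g_def
    by (smt (verit) mult_nonneg_nonneg zero_le_power2 divide_nonneg_nonneg)
  then have 1: "(1 - \<theta>) * (f y + g \<bullet> (x - y)) \<le> (1 - \<theta>) * f x"
    using \<open>\<theta> \<le> 1\<close> by (intro mult_left_mono) auto
  \<comment> \<open>The quadratic term kept here cancels the one of weight \<theta> in
    \<open>aa\<close>.\<close>
  have 2: "\<theta> * (f y + g \<bullet> (xstar - y) + \<mu> / 2 * (norm (xstar - y))\<^sup>2) \<le> \<theta> * f xstar"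
    using strongly_convex_grad[OF assms(1,2), of xstar] \<open>0 < \<theta>\<close> unfolding g_def
    by (intro mult_left_mono) auto
  have 3: "0 \<le> \<mu> / 2 * (\<theta> * (1 - \<theta>) * (norm (z - y))\<^sup>2)"
    using assms by (intro mult_nonneg_nonneg) auto
  show ?thesis
    using 1 2 3 unfolding g_def[symmetric] ag aa potential_sc_def
    by (simp add: algebra_simps add_divide_distrib diff_divide_distrib)
qed

text \<open>The state is frozen and only the sketch is integrated. The potential after the step is
  dominated by \<open>U\<close>, which is affine in the sketch direction up to two quadratic forms,
  so the moments bound its integral.\<close>

lemma nag_step_expected_decrease:
  fixes f :: "real ^ 'd \<Rightarrow> real" and P :: "'v \<Rightarrow> real ^ 'r ^ 'd"
  assumes N: "prob_space N" and P [measurable]: "P \<in> borel_measurable N"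
    and mom: "sketch_moments N P LL \<omega> ell" and L: "L = op_norm LL"
    and diff: "\<And>u. f differentiable (at u)" and sc: "strongly_convex \<mu> f"
    and min: "is_arg_min f (\<lambda>_. True) xstar" and smooth: "matrix_smooth LL f"
    and pos: "0 < \<mu>" "0 < L" "0 < \<omega>" "0 < ell" "0 < \<theta>" "\<theta> \<le> 1"
    and \<theta>: "\<theta>\<^sup>2 * (L * \<omega> * ell) = \<mu>"
  shows "(\<integral>\<^sup>+v. ennreal (case_prod (potential_sc f \<mu> xstar) (nag_step f \<mu> L ell \<theta> (x, z) (P v))) \<partial>N)
    \<le> ennreal ((1 - \<theta>) * potential_sc f \<mu> xstar x z)"
proof -
  interpret N: prob_space N by fact
  define y where "y = nag_mid \<theta> (x, z)"
  define g where "g = grad f y"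
  define d where "d v = (P v ** transpose (P v)) *v g" for v
  define a where "a = (1 - \<theta>) *\<^sub>R z + \<theta> *\<^sub>R y - xstar"
  define \<gamma> where "\<gamma> = 1 / (L * ell)"
  \<comment> \<open>\<open>b\<close> collects what does not depend on the sketch; \<open>c\<close>
    comes from smoothness with stepsize \<gamma>, and \<open>e\<close> equals
    \<open>\<mu> / 2 * (\<theta> / \<mu>)\<^sup>2\<close>, from the \<open>z\<close>-update.\<close>
  define b c e where "b = f y - f xstar + \<mu> / 2 * (a \<bullet> a)"
    and "c = \<gamma>\<^sup>2 / 2" and "e = \<theta>\<^sup>2 / (2 * \<mu>)"
  define U where "U = (\<lambda>v. b - \<gamma> * (g \<bullet> d v) + c * (d v \<bullet> (LL *v d v)) - \<theta> * (a \<bullet> d v)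
    + e * (d v \<bullet> d v))"
  note m = sketch_moments_vec[OF mom, where g = g, folded d_def]
  have le_U: "case_prod (potential_sc f \<mu> xstar) (nag_step f \<mu> L ell \<theta> (x, z) (P v)) \<le> U v" for v
  proof -
    have step: "nag_step f \<mu> L ell \<theta> (x, z) (P v) = (y - \<gamma> *\<^sub>R d v, xstar + (a - (\<theta> / \<mu>) *\<^sub>R d v))"
      by (simp add: nag_step_def Let_def y_def g_def d_def a_def \<gamma>_def)
    have "f (y - \<gamma> *\<^sub>R d v) \<le> f y + g \<bullet> (- (\<gamma> *\<^sub>R d v)) + 1 / 2 * ((\<gamma> *\<^sub>R d v) \<bullet> (LL *v (\<gamma> *\<^sub>R d v)))"
      using smooth[unfolded matrix_smooth_def, rule_format, of "y - \<gamma> *\<^sub>R d v" y]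
      by (simp add: g_def matrix_vector_mult_scaleR linear_neg[OF matrix_vector_mul_linear])
    also have "\<dots> = f y - \<gamma> * (g \<bullet> d v) + \<gamma>\<^sup>2 / 2 * (d v \<bullet> (LL *v d v))"
      by (simp add: matrix_vector_mult_scaleR power2_eq_square)
    finally have 1: "f (y - \<gamma> *\<^sub>R d v) \<le> \<dots>" .
    have "(norm (a - (\<theta> / \<mu>) *\<^sub>R d v))\<^sup>2
        = a \<bullet> a - 2 * (\<theta> / \<mu>) * (a \<bullet> d v) + (\<theta> / \<mu>)\<^sup>2 * (d v \<bullet> d v)"
      unfolding power2_norm_eq_inner
      by (simp add: inner_diff_left inner_diff_right inner_commute power2_eq_square)
    then have "\<mu> / 2 * (norm (a - (\<theta> / \<mu>) *\<^sub>R d v))\<^sup>2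
        = \<mu> / 2 * (a \<bullet> a) - \<theta> * (a \<bullet> d v) + \<theta>\<^sup>2 / (2 * \<mu>) * (d v \<bullet> d v)"
      using pos by (simp add: field_simps power2_eq_square)
    with 1 show ?thesis
      unfolding step potential_sc_def U_def b_def c_def e_def prod.case add_diff_cancel_left' by linarith
  qed
  have U: "integrable N U"
    unfolding U_def by (simp add: m(1,3,5))
  have "(\<integral>v. U v \<partial>N) = b - \<gamma> * (\<integral>v. g \<bullet> d v \<partial>N) + c * (\<integral>v. d v \<bullet> (LL *v d v) \<partial>N)
    - \<theta> * (\<integral>v. a \<bullet> d v \<partial>N) + e * (\<integral>v. d v \<bullet> d v \<partial>N)"
    unfolding U_def by (simp add: m(1,3,5) N.prob_space)
  \<comment> \<open>First moments are exact, so the linear terms may have either sign; the second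
    moments are only bounded, which is enough because \<open>c\<close> and \<open>e\<close> are
    nonnegative.\<close>
  also have "\<dots> \<le> b - \<gamma> * (g \<bullet> g) + c * (ell * L * (g \<bullet> g)) - \<theta> * (a \<bullet> g) + e * (\<omega> * (g \<bullet> g))"
    unfolding m(2) L using pos m(4,6)
    by (intro add_mono diff_mono mult_left_mono order_refl) (auto simp: c_def e_def)
  \<comment> \<open>Each of the two quadratic terms costs exactly half of the gain
    \<open>\<gamma> * (g \<bullet> g)\<close>: the first by the choice of \<gamma>, the second by
    that of \<theta>.\<close>
  also have "\<dots> = b - \<theta> * (a \<bullet> g)"
  proof -
    have "c * (ell * L * (g \<bullet> g)) = \<gamma> / 2 * (g \<bullet> g)"
      using pos by (simp add: c_def \<gamma>_def power2_eq_square)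
    moreover have "e * \<omega> = \<gamma> / 2"
      using pos unfolding e_def \<gamma>_def \<theta>[symmetric] by (simp add: field_simps)
    then have "e * (\<omega> * (g \<bullet> g)) = \<gamma> / 2 * (g \<bullet> g)"
      by (simp only: mult.assoc[symmetric])
    ultimately show ?thesis
      by linarith
  qed
  also have "\<dots> \<le> (1 - \<theta>) * potential_sc f \<mu> xstar x z"
    unfolding b_def g_def a_def using pos by (intro strongly_convex_mid_le diff sc y_def) auto
  finally have int: "(\<integral>v. U v \<partial>N) \<le> (1 - \<theta>) * potential_sc f \<mu> xstar x z" .
  \<comment> \<open>Nonnegativity, inherited from the dominated potential, identifies the
    nonnegative integral of \<open>U\<close> with its Bochner integral.\<close>
  have "0 \<le> U v" for v
    using le_U[of v] potential_sc_nonneg(3)[OF min pos(1)] by (force intro: order_trans simp: case_prod_beta)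
  then have "(\<integral>\<^sup>+v. ennreal (U v) \<partial>N) = ennreal (\<integral>v. U v \<partial>N)"
    using U by (intro nn_integral_eq_integral) auto
  moreover have "(\<integral>\<^sup>+v. ennreal (case_prod (potential_sc f \<mu> xstar) (nag_step f \<mu> L ell \<theta> (x, z) (P v))) \<partial>N)
      \<le> (\<integral>\<^sup>+v. ennreal (U v) \<partial>N)"
    using le_U by (intro nn_integral_mono ennreal_leI)
  ultimately show ?thesis
    using int ennreal_leI by fastforce
qed

section \<open>Ville's maximal inequality\<close>

text \<open>The supermartingale property is stated by integrals over events of the past, so
  conditional expectations do not appear and \<open>W\<close> may take the value infinity. The proof
  stops \<open>W\<close> when it first exceeds \<open>c\<close>.\<close>

lemma supermartingale_maximal_inequality:
  fixes W :: "nat \<Rightarrow> 'a \<Rightarrow> ennreal"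
  assumes "filtration (space M) F" and sub: "\<And>k. sets (F k) \<subseteq> sets M"
    and W: "\<And>k. W k \<in> borel_measurable (F k)"
    and decr: "\<And>k A. A \<in> sets (F k) \<Longrightarrow> (\<integral>\<^sup>+w\<in>A. W (Suc k) w \<partial>M) \<le> (\<integral>\<^sup>+w\<in>A. W k w \<partial>M)"
  shows "c * emeasure M {w \<in> space M. \<exists>k. c < W k w} \<le> (\<integral>\<^sup>+w. W 0 w \<partial>M)"
proof -
  interpret filtration "space M" F by fact
  have W_M [measurable]: "W k \<in> borel_measurable M" for k
    using measurable_mono[of borel borel "F k" M] W sub[of k] by (auto simp: space_F)
  \<comment> \<open>\<open>W\<close> has not exceeded \<open>c\<close> before time \<open>n\<close>; as time \<open>n\<close> itself is excluded, \<open>B (Suc n)\<close>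
    lies in \<open>F n\<close>.\<close>
  define B where "B n = {w \<in> space M. \<forall>j\<in>{..<n}. W j w \<le> c}" for n
  have B_sets [measurable]: "B n \<in> sets M" for n
    unfolding B_def by measurable
  have B_F: "B (Suc n) \<in> sets (F n)" for n
  proof -
    have [measurable]: "W j \<in> borel_measurable (F n)" if "j < Suc n" for j
      using measurable_mono[of borel borel "F j" "F n"] W[of j] sets_F_mono[of j n] that
      by (auto simp: space_F)
    have "{w \<in> space (F n). \<forall>j\<in>{..<Suc n}. W j w \<le> c} \<in> sets (F n)"
      by (intro sets.sets_Collect_finite_All) auto
    then show ?thesis
      by (simp only: B_def space_F)
  qed
  \<comment> \<open>The left side is a lower bound for the integral of the stopped process: where
    \<open>c\<close> was exceeded before time \<open>n\<close>, the value is replaced by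
    \<open>c\<close>.\<close>
  have bound: "c * emeasure M (space M - B n) + (\<integral>\<^sup>+w\<in>B n. W n w \<partial>M) \<le> (\<integral>\<^sup>+w. W 0 w \<partial>M)" for n
  proof (induction n)
    case 0
    have "(\<integral>\<^sup>+w\<in>B 0. W 0 w \<partial>M) = (\<integral>\<^sup>+w. W 0 w \<partial>M)"
      by (intro nn_integral_cong) (simp add: B_def)
    then show ?case
      by (simp add: B_def)
  next
    case (Suc n)
    \<comment> \<open>On \<open>D\<close> the level is exceeded for the first time at time
      \<open>n\<close>.\<close>
    define D where "D = B n - B (Suc n)"
    have D [measurable]: "D \<in> sets M"
      by (simp add: D_def)
    have Un: "space M - B (Suc n) = (space M - B n) \<union> D" "B n = D \<union> B (Suc n)"
      by (auto simp: B_def D_def less_Suc_eq)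
    have disj: "(space M - B n) \<inter> D = {}" "D \<inter> B (Suc n) = {}"
      by (auto simp: D_def)
    have "c * emeasure M D = (\<integral>\<^sup>+w\<in>D. c \<partial>M)"
      by (simp add: nn_integral_cmult_indicator)
    also have "\<dots> \<le> (\<integral>\<^sup>+w\<in>D. W n w \<partial>M)"
      by (intro nn_integral_mono) (auto simp: D_def B_def less_Suc_eq indicator_def)
    finally have D_le: "c * emeasure M D \<le> (\<integral>\<^sup>+w\<in>D. W n w \<partial>M)" .
    have "c * emeasure M (space M - B (Suc n)) + (\<integral>\<^sup>+w\<in>B (Suc n). W (Suc n) w \<partial>M)
        = c * emeasure M (space M - B n) + (c * emeasure M D + (\<integral>\<^sup>+w\<in>B (Suc n). W (Suc n) w \<partial>M))"
      unfolding Un(1) using disj(1)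
      by (subst plus_emeasure[symmetric]) (auto simp: distrib_left add.assoc)
    also have "\<dots> \<le> c * emeasure M (space M - B n)
        + ((\<integral>\<^sup>+w\<in>D. W n w \<partial>M) + (\<integral>\<^sup>+w\<in>B (Suc n). W n w \<partial>M))"
      by (intro add_mono order_refl D_le decr B_F)
    also have "(\<integral>\<^sup>+w\<in>D. W n w \<partial>M) + (\<integral>\<^sup>+w\<in>B (Suc n). W n w \<partial>M) = (\<integral>\<^sup>+w\<in>B n. W n w \<partial>M)"
      unfolding Un(2) using disj(2) by (intro nn_integral_disjoint_pair[symmetric]) auto
    finally show ?case
      using Suc by (rule order_trans)
  qed
  have "{w \<in> space M. \<exists>k. c < W k w} = (\<Union>n. space M - B n)"
    by (auto simp: B_def not_le) (meson leD lessI lessThan_iff)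
  moreover have "incseq (\<lambda>n. space M - B n)"
    by (auto simp: incseq_def B_def)
  ultimately have "c * emeasure M {w \<in> space M. \<exists>k. c < W k w} = (SUP n. c * emeasure M (space M - B n))"
    by (subst SUP_mult_left_ennreal[symmetric]) (auto simp: SUP_emeasure_incseq image_subset_iff)
  \<comment> \<open>The second summand of \<open>bound\<close> is dropped, uniformly in
    \<open>n\<close>.\<close>
  also have "\<dots> \<le> (\<integral>\<^sup>+w. W 0 w \<partial>M)"
    by (intro SUP_least order_trans[OF add_increasing2[OF zero_le order_refl] bound])
  finally show ?thesis .
qed

section \<open>Histories and integration over an independent next sample\<close>

definition history :: "(nat \<Rightarrow> 'w \<Rightarrow> 'p) \<Rightarrow> nat \<Rightarrow> 'w \<Rightarrow> nat \<Rightarrow> 'p" where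
  "history Y k w = (\<lambda>i\<in>{..<k}. Y i w)"

text \<open>Index \<open>k\<close> is excluded: the state at time \<open>k\<close> is already
  determined, while \<open>Y k\<close> is the fresh sample.\<close>

abbreviation natural_filtration :: "'w measure \<Rightarrow> 'p measure \<Rightarrow> (nat \<Rightarrow> 'w \<Rightarrow> 'p) \<Rightarrow> nat \<Rightarrow> 'w measure" where
  "natural_filtration M S Y k \<equiv> vimage_algebra (space M) (history Y k) (PiM {..<k} (\<lambda>_. S))"

context
  fixes M :: "'w measure" and S :: "'p measure" and Y :: "nat \<Rightarrow> 'w \<Rightarrow> 'p"
  assumes Y: "\<And>i. Y i \<in> M \<rightarrow>\<^sub>M S"
begin

lemma history_space: "history Y k \<in> space M \<rightarrow> space (PiM {..<k} (\<lambda>_. S))"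
  using measurable_space[OF Y] by (auto simp: history_def space_PiM)

lemma measurable_history [measurable]: "history Y k \<in> M \<rightarrow>\<^sub>M PiM {..<k} (\<lambda>_. S)"
  unfolding history_def[abs_def] by (intro measurable_restrict Y)

lemma measurable_natural_filtration:
  assumes "i < k"
  shows "Y i \<in> natural_filtration M S Y k \<rightarrow>\<^sub>M S"
proof -
  have "(\<lambda>w. history Y k w i) \<in> natural_filtration M S Y k \<rightarrow>\<^sub>M S"
    using assms
    by (intro measurable_compose[OF measurable_vimage_algebra1[OF history_space] measurable_component_singleton]) auto
  then show ?thesis
    using assms by (simp add: history_def)
qed

lemma sets_natural_filtration: "sets (natural_filtration M S Y k) \<subseteq> sets M"
  by (intro sets_image_in_sets measurable_history) simp

lemma filtration_natural_filtration: "filtration (space M) (natural_filtration M S Y)"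
proof
  fix i j :: nat
  assume "i \<le> j"
  then have "history Y i \<in> natural_filtration M S Y j \<rightarrow>\<^sub>M PiM {..<i} (\<lambda>_. S)"
    unfolding history_def[of Y i, abs_def] by (intro measurable_restrict measurable_natural_filtration) auto
  then show "sets (natural_filtration M S Y i) \<le> sets (natural_filtration M S Y j)"
    by (intro sets_image_in_sets) simp_all
qed simp

end

text \<open>By independence the joint law of history and next sample is a product, so Tonelli allows
  the history to be frozen while the sample is integrated. This plays the part of conditioning on
  the past.\<close>

lemma (in prob_space) set_nn_integral_indep_next_le:
  assumes ind: "indep_vars (\<lambda>_. S) Y (UNIV :: nat set)"
    and h [measurable]: "h \<in> borel_measurable (PiM {..<k} (\<lambda>_. S) \<Otimes>\<^sub>M S)"
    and u [measurable]: "u \<in> borel_measurable (PiM {..<k} (\<lambda>_. S))"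
    and le: "\<And>p. p \<in> space (PiM {..<k} (\<lambda>_. S)) \<Longrightarrow> (\<integral>\<^sup>+v. h (p, v) \<partial>distr M S (Y k)) \<le> u p"
    and A: "A \<in> sets (natural_filtration M S Y k)"
  shows "(\<integral>\<^sup>+w\<in>A. h (history Y k w, Y k w) \<partial>M) \<le> (\<integral>\<^sup>+w\<in>A. u (history Y k w) \<partial>M)"
proof -
  have Y [measurable]: "Y i \<in> M \<rightarrow>\<^sub>M S" for i
    using ind by (simp add: indep_vars_def)
  let ?H = "PiM {..<k} (\<lambda>_. S)" and ?X = "history Y k"
  have X [measurable]: "?X \<in> M \<rightarrow>\<^sub>M ?H"
    by (rule measurable_history[OF Y])
  obtain A' where A' [measurable]: "A' \<in> sets ?H" and A_eq: "A = ?X -` A' \<inter> space M"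
    using A unfolding sets_vimage_algebra2[OF history_space[OF Y]] by auto
  \<comment> \<open>\<open>indep_var\<close> requires both variables to have the same type, so \<open>Y k\<close> is viewed as a function
    on \<open>{k}\<close>.\<close>
  let ?K = "PiM {k} (\<lambda>_. S)" and ?Z = "\<lambda>w. \<lambda>i\<in>{k}. Y i w"
  have "indep_var ?H ?X ?K ?Z"
    unfolding history_def[abs_def] by (intro indep_var_restrict[OF ind]) auto
  then have Z [measurable]: "?Z \<in> M \<rightarrow>\<^sub>M ?K"
    and distr: "distr M ?H ?X \<Otimes>\<^sub>M distr M ?K ?Z = distr M (?H \<Otimes>\<^sub>M ?K) (\<lambda>w. (?X w, ?Z w))"
    by (simp_all add: indep_var_distribution_eq)
  interpret Q: prob_space "distr M ?K ?Z"
    by (rule prob_space_distr) fact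
  \<comment> \<open>An event of the past is the preimage of some \<open>A'\<close>, so its indicator
    depends on the history alone and leaves the inner integral.\<close>
  define hA where "hA = (\<lambda>(p, q). h (p, q k) * indicator A' p)"
  have hA [measurable]: "hA \<in> borel_measurable (?H \<Otimes>\<^sub>M ?K)"
    unfolding hA_def by measurable
  have hA_int: "(\<integral>\<^sup>+q. hA (p, q) \<partial>distr M ?K ?Z) = (\<integral>\<^sup>+v. h (p, v) \<partial>distr M S (Y k)) * indicator A' p"
    if [measurable]: "p \<in> space ?H" for p
  proof -
    have "(\<integral>\<^sup>+q. hA (p, q) \<partial>distr M ?K ?Z) = (\<integral>\<^sup>+w. hA (p, ?Z w) \<partial>M)"
      by (subst nn_integral_distr) auto
    also have "\<dots> = (\<integral>\<^sup>+w. h (p, Y k w) \<partial>M) * indicator A' p"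
      by (subst nn_integral_multc[symmetric]) (auto simp: hA_def)
    finally show ?thesis
      by (subst nn_integral_distr) auto
  qed
  have "(\<integral>\<^sup>+w\<in>A. h (?X w, Y k w) \<partial>M) = (\<integral>\<^sup>+w. hA (?X w, ?Z w) \<partial>M)"
    by (intro nn_integral_cong) (simp add: A_eq hA_def indicator_def)
  also have "\<dots> = (\<integral>\<^sup>+r. hA r \<partial>(distr M ?H ?X \<Otimes>\<^sub>M distr M ?K ?Z))"
    unfolding distr by (subst nn_integral_distr) auto
  also have "\<dots> = (\<integral>\<^sup>+p. \<integral>\<^sup>+q. hA (p, q) \<partial>distr M ?K ?Z \<partial>distr M ?H ?X)"
    by (intro Q.nn_integral_fst[symmetric]) (simp cong: measurable_cong_sets)
  also have "\<dots> = (\<integral>\<^sup>+p. (\<integral>\<^sup>+v. h (p, v) \<partial>distr M S (Y k)) * indicator A' p \<partial>distr M ?H ?X)"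
    by (intro nn_integral_cong hA_int) simp
  also have "\<dots> \<le> (\<integral>\<^sup>+p. u p * indicator A' p \<partial>distr M ?H ?X)"
    using le by (intro nn_integral_mono mult_right_mono) auto
  also have "\<dots> = (\<integral>\<^sup>+w. u (?X w) * indicator A' (?X w) \<partial>M)"
    by (subst nn_integral_distr) auto
  also have "\<dots> = (\<integral>\<^sup>+w\<in>A. u (?X w) \<partial>M)"
    by (intro nn_integral_cong) (simp add: A_eq indicator_def)
  finally show ?thesis .
qed

section \<open>Nonnegative adapted processes contracting geometrically in mean\<close>

context prob_space
begin

context
  fixes F :: "nat \<Rightarrow> 'a measure" and V :: "nat \<Rightarrow> 'a \<Rightarrow> real" and \<rho> v\<^sub>0 :: real
  assumes filt: "filtration (space M) F" and sub: "\<And>k. sets (F k) \<subseteq> sets M"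
    and V_F: "\<And>k. V k \<in> borel_measurable (F k)"
    and V_nonneg: "\<And>k w. 0 \<le> V k w"
    and V_0: "\<And>w. w \<in> space M \<Longrightarrow> V 0 w = v\<^sub>0"
    and \<rho>: "0 \<le> \<rho>"
    and decr: "\<And>k A. A \<in> sets (F k) \<Longrightarrow>
      (\<integral>\<^sup>+w\<in>A. ennreal (V (Suc k) w) \<partial>M) \<le> ennreal \<rho> * (\<integral>\<^sup>+w\<in>A. ennreal (V k w) \<partial>M)"
begin

lemma geometric_V_measurable [measurable]: "V k \<in> borel_measurable M"
  using measurable_mono[of borel borel "F k" M] V_F sub[of k] filtration.space_F[OF filt] by auto

lemma geometric_v0_nonneg: "0 \<le> v\<^sub>0"
  using V_nonneg V_0 not_empty by (metis ex_in_conv)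

lemma geometric_nn_integral: "(\<integral>\<^sup>+w. ennreal (V k w) \<partial>M) \<le> ennreal (v\<^sub>0 * \<rho> ^ k)"
proof (induction k)
  case 0
  have "(\<integral>\<^sup>+w. ennreal (V 0 w) \<partial>M) = (\<integral>\<^sup>+w. ennreal v\<^sub>0 \<partial>M)"
    by (intro nn_integral_cong) (simp add: V_0)
  then show ?case
    by (simp add: emeasure_space_1)
next
  case (Suc k)
  have "space M \<in> sets (F k)"
    using filtration.space_F[OF filt] sets.top by metis
  from decr[OF this] have "(\<integral>\<^sup>+w. ennreal (V (Suc k) w) \<partial>M) \<le> ennreal \<rho> * (\<integral>\<^sup>+w. ennreal (V k w) \<partial>M)"
    by (simp add: nn_set_integral_space)
  also have "\<dots> \<le> ennreal \<rho> * ennreal (v\<^sub>0 * \<rho> ^ k)"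
    using Suc by (intro mult_left_mono) auto
  also have "\<dots> = ennreal (v\<^sub>0 * \<rho> ^ Suc k)"
    using \<rho> geometric_v0_nonneg by (simp add: ac_simps flip: ennreal_mult)
  finally show ?case .
qed

text \<open>Covers both degenerate cases: \<open>v\<^sub>0 = 0\<close> at every time, and
  \<open>\<rho> = 0\<close> at every positive time.\<close>

lemma geometric_AE_zero:
  assumes "v\<^sub>0 * \<rho> ^ k = 0"
  shows "AE w in M. V k w = 0"
proof -
  have "(\<integral>\<^sup>+w. ennreal (V k w) \<partial>M) = 0"
    using geometric_nn_integral[of k] assms by simp
  then have "AE w in M. ennreal (V k w) = 0"
    by (subst (asm) nn_integral_0_iff_AE) auto
  then show ?thesis
    using V_nonneg by (auto simp: ennreal_eq_0_iff intro: antisym)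
qed

text \<open>Ville's inequality for \<open>V k w / \<rho> ^ k\<close> at level
  \<open>v\<^sub>0 / \<eta>\<close>. The case \<open>v\<^sub>0 = 0\<close> is separate because the
  level would then be zero.\<close>

lemma geometric_maximal:
  assumes "0 < \<rho>" "0 < \<eta>"
  shows "1 - \<eta> \<le> \<P>(w in M. \<forall>k. V k w \<le> v\<^sub>0 / \<eta> * \<rho> ^ k)"
proof (cases "v\<^sub>0 = 0")
  case True
  then have "AE w in M. \<forall>k. V k w = 0"
    using geometric_AE_zero by (simp add: AE_all_countable)
  then have "AE w in M. \<forall>k. V k w \<le> v\<^sub>0 / \<eta> * \<rho> ^ k"
    by eventually_elim (simp add: True)
  then show ?thesis
    using assms(2) by (subst prob_eq_1[THEN iffD2]) auto
next
  case False
  then have c: "0 < v\<^sub>0 / \<eta>"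
    using geometric_v0_nonneg assms by simp
  \<comment> \<open>The product form lets the constant be pulled out of nonnegative
    integrals.\<close>
  define W where "W k w = ennreal ((1 / \<rho>) ^ k) * ennreal (V k w)" for k w
  have W: "W k w = ennreal (V k w / \<rho> ^ k)" for k w
    using assms V_nonneg by (simp add: W_def divide_inverse power_inverse mult.commute flip: ennreal_mult)
  have step: "(\<integral>\<^sup>+w\<in>A. W (Suc k) w \<partial>M) \<le> (\<integral>\<^sup>+w\<in>A. W k w \<partial>M)" if A: "A \<in> sets (F k)" for k A
  proof -
    have [measurable]: "A \<in> sets M"
      using A sub by auto
    have "(\<integral>\<^sup>+w\<in>A. W (Suc k) w \<partial>M) = ennreal ((1 / \<rho>) ^ Suc k) * (\<integral>\<^sup>+w\<in>A. ennreal (V (Suc k) w) \<partial>M)"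
      unfolding W_def by (simp add: mult.assoc nn_integral_cmult)
    also have "\<dots> \<le> ennreal ((1 / \<rho>) ^ Suc k) * (ennreal \<rho> * (\<integral>\<^sup>+w\<in>A. ennreal (V k w) \<partial>M))"
      by (intro mult_left_mono decr A) simp
    also have "\<dots> = ennreal ((1 / \<rho>) ^ k) * (\<integral>\<^sup>+w\<in>A. ennreal (V k w) \<partial>M)"
      using assms by (simp add: field_simps flip: mult.assoc ennreal_mult)
    also have "\<dots> = (\<integral>\<^sup>+w\<in>A. W k w \<partial>M)"
      unfolding W_def by (simp add: mult.assoc nn_integral_cmult)
    finally show ?thesis .
  qed
  define E where "E = {w \<in> space M. \<exists>k. ennreal (v\<^sub>0 / \<eta>) < W k w}"
  have [measurable]: "W k \<in> borel_measurable M" for k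
    unfolding W_def by measurable
  have [measurable]: "E \<in> sets M"
    unfolding E_def by measurable
  have "ennreal (v\<^sub>0 / \<eta>) * emeasure M E \<le> (\<integral>\<^sup>+w. W 0 w \<partial>M)"
    unfolding E_def
  proof (rule supermartingale_maximal_inequality[where F = F])
    show "W k \<in> borel_measurable (F k)" for k
      using V_F[measurable] unfolding W_def by measurable
  qed (use filt sub step in auto)
  also have "\<dots> \<le> ennreal v\<^sub>0"
    using geometric_nn_integral[of 0] by (simp add: W_def)
  finally have "v\<^sub>0 / \<eta> * prob E \<le> v\<^sub>0"
    using c geometric_v0_nonneg by (simp add: emeasure_eq_measure flip: ennreal_mult)
  then have "prob E \<le> \<eta>"
    using False geometric_v0_nonneg assms by (simp add: field_simps)
  then have "1 - \<eta> \<le> prob (space M - E)"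
    by (simp add: prob_compl)
  also have "space M - E = {w \<in> space M. \<forall>k. V k w \<le> v\<^sub>0 / \<eta> * \<rho> ^ k}"
  proof -
    have "W k w \<le> ennreal (v\<^sub>0 / \<eta>) \<longleftrightarrow> V k w \<le> v\<^sub>0 / \<eta> * \<rho> ^ k" for k w
      using c assms(1) unfolding W
      by (simp only: ennreal_le_iff[OF less_imp_le] pos_divide_le_eq zero_less_power)
    then show ?thesis
      by (auto simp: E_def simp flip: not_le)
  qed
  finally show ?thesis .
qed

text \<open>Comparing the mean bound \<open>v\<^sub>0 * \<rho> ^ k\<close> with the threshold
  \<open>v\<^sub>0 * q ^ k\<close> gives exceedance probabilities at most
  \<open>(\<rho> / q) ^ k\<close>, which are summable. For \<open>v\<^sub>0 = 0\<close> the
  threshold vanishes and Markov's inequality says nothing.\<close>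

lemma geometric_eventually:
  assumes "0 < q" "\<rho> < q"
  shows "AE w in M. \<exists>n. \<forall>k\<ge>n. V k w \<le> v\<^sub>0 * q ^ k"
proof (cases "v\<^sub>0 = 0")
  case True
  then have "AE w in M. \<forall>k. V k w = 0"
    using geometric_AE_zero by (simp add: AE_all_countable)
  then show ?thesis
    by eventually_elim (simp add: True)
next
  case False
  then have pos: "0 < v\<^sub>0"
    using geometric_v0_nonneg by simp
  define A where "A k = {w \<in> space M. v\<^sub>0 * q ^ k \<le> V k w}" for k
  have [measurable]: "A k \<in> sets M" for k
    unfolding A_def by measurable
  have A_le: "prob (A k) \<le> (\<rho> / q) ^ k" for k
  proof -
    have c: "0 < v\<^sub>0 * q ^ k"
      using pos assms by simp
    have "ennreal (v\<^sub>0 * q ^ k) * emeasure M (A k) = (\<integral>\<^sup>+w\<in>A k. ennreal (v\<^sub>0 * q ^ k) \<partial>M)"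
      by (simp add: nn_integral_cmult_indicator)
    also have "\<dots> \<le> (\<integral>\<^sup>+w. ennreal (V k w) \<partial>M)"
      by (intro nn_integral_mono) (auto simp: A_def indicator_def intro: ennreal_leI)
    also have "\<dots> \<le> ennreal (v\<^sub>0 * \<rho> ^ k)"
      by (rule geometric_nn_integral)
    finally have "v\<^sub>0 * q ^ k * prob (A k) \<le> v\<^sub>0 * \<rho> ^ k"
      using c pos \<rho> by (simp add: emeasure_eq_measure flip: ennreal_mult)
    then show ?thesis
      using pos assms by (simp add: power_divide field_simps)
  qed
  have "summable (\<lambda>k. (\<rho> / q) ^ k)"
    using \<rho> assms by (intro summable_geometric) simp
  then have "summable (\<lambda>k. prob (A k))"
    by (rule summable_comparison_test'[where N = 0]) (simp add: A_le)
  then have "AE w in M. eventually (\<lambda>k. w \<in> space M - A k) sequentially"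
    by (intro borel_cantelli_AE1) (auto simp: emeasure_eq_measure)
  then show ?thesis
    by eventually_elim (fastforce simp: eventually_sequentially A_def not_le intro: less_imp_le)
qed

end

end

section \<open>Rates for the randomized accelerated method\<close>

lemma op_norm_pos:
  fixes A :: "real ^ 'n ^ 'm"
  assumes "A \<noteq> 0"
  shows "0 < op_norm A"
proof -
  have "\<exists>x. A *v x \<noteq> 0"
    using assms by (metis matrix_eq matrix_vector_mult_0)
  then show ?thesis
    by (simp add: op_norm_def onorm_pos_lt)
qed

theorem propositionI2:
  fixes f :: "real ^ 'd \<Rightarrow> real"
    and \<mu> L \<omega> ell \<theta> \<rho> :: real
    and LL :: "real ^ 'd ^ 'd"
    and xstar x0 :: "real ^ 'd"
    and N :: "'v measure" and P :: "'v \<Rightarrow> real ^ 'r ^ 'd"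
    and M :: "'w measure" and Pk :: "nat \<Rightarrow> 'w \<Rightarrow> real ^ 'r ^ 'd"
    and x y z :: "nat \<Rightarrow> 'w \<Rightarrow> real ^ 'd"
    and \<Phi> :: "nat \<Rightarrow> 'w \<Rightarrow> real"
  assumes "2 \<le> CARD('d)" and "CARD('r) \<le> CARD('d)"
    and "\<And>u. f differentiable (at u)"
    and "\<mu> > 0" and "strongly_convex \<mu> f"
    and "is_arg_min f (\<lambda>_. True) xstar"
    and "psd LL" and "LL \<noteq> 0" and "matrix_smooth LL f"
    and L: "L = op_norm LL"
    and "prob_space N" and "P \<in> borel_measurable N"
    and "\<omega> > 0" and "ell > 0" and "sketch_moments N P LL \<omega> ell"
    and "prob_space M"
    and "prob_space.indep_vars M (\<lambda>_. borel) Pk UNIV"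
    and "\<And>k. distr M borel (Pk k) = distr N borel P"
    and \<theta>: "\<theta> = sqrt (\<mu> / (L * \<omega> * ell))"
    and "\<And>w. w \<in> space M \<Longrightarrow>
           rs_nag_sc f \<mu> L ell \<theta> x0 (\<lambda>k. Pk k w) (\<lambda>k. x k w) (\<lambda>k. y k w) (\<lambda>k. z k w)"
    and \<Phi>: "\<And>k w. \<Phi> k w = potential_sc f \<mu> xstar (x k w) (z k w)"
    and \<rho>: "\<rho> = 1 - \<theta>"
  shows "(\<rho> = 0 \<longrightarrow>
            (AE w in M. \<forall>k\<ge>1. \<Phi> k w = 0) \<and>
            (\<forall>\<eta>\<in>{0<..<1}. AE w in M.
               f (x 0 w) - f xstar \<le> \<Phi> 0 w / \<eta> \<and> (\<forall>k\<ge>1. f (x k w) - f xstar = 0)) \<and>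
            (\<forall>q\<in>{0<..<1}. AE w in M. \<forall>k\<ge>1. f (x k w) - f xstar \<le> \<Phi> 0 w * q ^ k)) \<and>
         (\<rho> \<in> {0<..<1} \<longrightarrow>
            (\<forall>\<eta>\<in>{0<..<1}.
               \<P>(w in M. \<forall>k. f (x k w) - f xstar \<le> \<Phi> 0 w / \<eta> * \<rho> ^ k) \<ge> 1 - \<eta>) \<and>
            (\<forall>q\<in>{\<rho><..<1}. \<exists>K \<in> measurable M (count_space (UNIV :: nat set)).
               AE w in M. \<forall>k\<ge>K w. f (x k w) - f xstar \<le> \<Phi> 0 w * q ^ k))"
proof -
  note diff = assms(3) and \<mu> = assms(4) and sc = assms(5) and min = assms(6)
    and smooth = assms(9) and N = assms(11) and P = assms(12) and mom = assms(15)
    and ind = assms(17) and Pk_distr = assms(18) and alg = assms(20)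
  interpret M: prob_space M
    by fact
  have "0 < L"
    unfolding L using assms(8) by (rule op_norm_pos)
  then have D: "0 < L * \<omega> * ell"
    using assms(13,14) by simp
  then have \<theta>_pos: "0 < \<theta>" and \<theta>_sq: "\<theta>\<^sup>2 * (L * \<omega> * ell) = \<mu>"
    using \<mu> less_imp_neq[OF D] by (simp_all add: \<theta>)
  have Pk [measurable]: "Pk i \<in> borel_measurable M" for i
    using ind by (simp add: M.indep_vars_def)

  let ?F = "natural_filtration M borel Pk"
  let ?pot = "\<lambda>s. potential_sc f \<mu> xstar (fst s) (snd s)"
  let ?st = "\<lambda>p k. nag_state f \<mu> L ell \<theta> x0 p k"
  \<comment> \<open>The given iterates are constrained only on \<open>space M\<close>. Running the
    recursion on the sketches defines the potential everywhere, and it agrees with \<Phi> on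
    \<open>space M\<close>.\<close>
  define V where "V k w = ?pot (?st (\<lambda>i. Pk i w) k)" for k w
  define v0 where "v0 = potential_sc f \<mu> xstar x0 x0"
  have xz: "(x k w, z k w) = ?st (\<lambda>i. Pk i w) k" if "w \<in> space M" for k w
    using alg[OF that] by (rule rs_nag_sc_nag_state)
  have \<Phi>_V: "\<Phi> k w = V k w" if "w \<in> space M" for k w
    unfolding V_def \<Phi> xz[OF that, symmetric] by simp
  have V_0: "V 0 w = v0" for w
    by (simp add: V_def v0_def)
  have V_nonneg: "0 \<le> V k w" for k w
    unfolding V_def using min \<mu> by (rule potential_sc_nonneg)
  have f_le: "f (x k w) - f xstar \<le> V k w" if "w \<in> space M" for k w
    using potential_sc_nonneg(2)[OF min \<mu>] by (simp add: \<Phi> flip: \<Phi>_V[OF that])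
  have f_nonneg: "0 \<le> f u - f xstar" for u
    using potential_sc_nonneg(1)[OF min \<mu>] .
  note [measurable] = borel_measurable_potential_sc[OF diff, of \<mu> xstar]
  have V_F: "V k \<in> borel_measurable (?F k)" for k
  proof -
    have "(\<lambda>w. ?st (\<lambda>i. Pk i w) k) \<in> ?F k \<rightarrow>\<^sub>M borel \<Otimes>\<^sub>M borel"
      by (intro borel_measurable_nag_state diff measurable_natural_filtration Pk)
    then show ?thesis
      unfolding V_def by measurable
  qed
  have st_M [measurable]: "(\<lambda>w. ?st (\<lambda>i. Pk i w) k) \<in> M \<rightarrow>\<^sub>M borel \<Otimes>\<^sub>M borel" for k
    by (intro borel_measurable_nag_state diff Pk)
  have V_M [measurable]: "V k \<in> borel_measurable M" for k
    unfolding V_def by measurable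
  \<comment> \<open>Measurability is transferred from \<open>nag_state\<close>, with which the
    iterates agree on \<open>space M\<close>.\<close>
  have fx [measurable]: "(\<lambda>w. f (x k w)) \<in> borel_measurable M" for k
  proof -
    have "continuous_on UNIV f"
      using diff by (meson continuous_at_imp_continuous_on differentiable_imp_continuous_within)
    then have [measurable]: "f \<in> borel_measurable borel"
      by (rule borel_measurable_continuous_onI)
    have "(\<lambda>w. f (fst (?st (\<lambda>i. Pk i w) k))) \<in> borel_measurable M"
      by measurable
    then show ?thesis
      by (rule measurable_cong[THEN iffD1, rotated]) (simp flip: xz)
  qed

  \<comment> \<open>The condition \<open>0 \<le> \<rho>\<close> is the bound
    \<open>\<theta> \<le> 1\<close> of the one-step estimate; both cases of the theorem supply
    it.\<close>
  have decr: "(\<integral>\<^sup>+w\<in>A. ennreal (V (Suc k) w) \<partial>M) \<le> ennreal \<rho> * (\<integral>\<^sup>+w\<in>A. ennreal (V k w) \<partial>M)"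
    if "0 \<le> \<rho>" and A: "A \<in> sets (?F k)" for k A
  proof -
    let ?h = "\<lambda>(p, v). ennreal (?pot (nag_step f \<mu> L ell \<theta> (?st p k) v))"
    let ?u = "\<lambda>p. ennreal \<rho> * ennreal (?pot (?st p k))"
    let ?H = "PiM {..<k} (\<lambda>_. borel :: (real ^ 'r ^ 'd) measure)"
    have st [measurable]: "(\<lambda>p. ?st p k) \<in> ?H \<rightarrow>\<^sub>M borel \<Otimes>\<^sub>M borel"
      by (intro borel_measurable_nag_state diff measurable_component_singleton) simp
    have "(\<lambda>r. nag_step f \<mu> L ell \<theta> (?st (fst r) k) (snd r)) \<in> ?H \<Otimes>\<^sub>M borel \<rightarrow>\<^sub>M borel \<Otimes>\<^sub>M borel"
      by (intro borel_measurable_nag_step diff measurable_compose[OF measurable_fst st]) measurable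
    then have h: "?h \<in> borel_measurable (?H \<Otimes>\<^sub>M borel)"
      unfolding case_prod_beta by measurable
    have u: "?u \<in> borel_measurable ?H"
      by measurable
    have le: "(\<integral>\<^sup>+v. ?h (p, v) \<partial>distr M borel (Pk k)) \<le> ?u p" for p
    proof -
      obtain a b where s: "?st p k = (a, b)"
        by fastforce
      have [measurable]: "(\<lambda>v. nag_step f \<mu> L ell \<theta> (a, b) v) \<in> borel \<rightarrow>\<^sub>M borel \<Otimes>\<^sub>M borel"
        by (intro borel_measurable_nag_step diff) (auto simp: space_pair_measure)
      have "(\<lambda>v. ennreal (?pot (nag_step f \<mu> L ell \<theta> (a, b) v))) \<in> borel_measurable borel"
        by measurable
      \<comment> \<open>Equality in law moves the integral to \<open>N\<close>, where the moment
        conditions are stated.\<close>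
      then have "(\<integral>\<^sup>+v. ?h (p, v) \<partial>distr M borel (Pk k))
          = (\<integral>\<^sup>+v. ennreal (case_prod (potential_sc f \<mu> xstar) (nag_step f \<mu> L ell \<theta> (a, b) (P v))) \<partial>N)"
        unfolding Pk_distr using P by (subst nn_integral_distr) (auto simp: case_prod_beta s)
      also have "\<dots> \<le> ennreal ((1 - \<theta>) * potential_sc f \<mu> xstar a b)"
        using that(1) \<rho> \<mu> \<open>0 < L\<close> assms(13,14) \<theta>_pos \<theta>_sq
        by (intro nag_step_expected_decrease[OF N P mom L diff sc min smooth]) auto
      finally show ?thesis
        using that(1) potential_sc_nonneg(3)[OF min \<mu>] by (simp add: s ennreal_mult \<rho>)
    qed
    have hist: "?st (history Pk k w) k = ?st (\<lambda>i. Pk i w) k" for w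
      by (rule nag_state_cong) (simp add: history_def)
    have [measurable]: "A \<in> sets M"
      by (rule subsetD[OF sets_natural_filtration[OF Pk] A])
    have "(\<integral>\<^sup>+w\<in>A. ?h (history Pk k w, Pk k w) \<partial>M) \<le> (\<integral>\<^sup>+w\<in>A. ?u (history Pk k w) \<partial>M)"
      by (rule M.set_nn_integral_indep_next_le[OF ind h u le A])
    also have "\<dots> = ennreal \<rho> * (\<integral>\<^sup>+w\<in>A. ennreal (V k w) \<partial>M)"
      unfolding hist V_def[symmetric] by (simp add: mult.assoc nn_integral_cmult)
    finally show ?thesis
      by (simp add: hist V_def)
  qed
  note super = filtration_natural_filtration[OF Pk] sets_natural_filtration[OF Pk] V_F V_nonneg V_0 _ decr

  show ?thesis
  proof (intro conjI impI)
    assume "\<rho> = 0"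
    \<comment> \<open>The restriction to positive \<open>k\<close> matters, since
      \<open>0 ^ 0 = 1\<close>.\<close>
    then have "AE w in M. V k w = 0" if "1 \<le> k" for k
      using that by (intro M.geometric_AE_zero[OF super]) auto
    then have AE_V: "AE w in M. \<forall>k\<ge>1. V k w = 0"
      by (simp add: AE_all_countable)
    then show "AE w in M. \<forall>k\<ge>1. \<Phi> k w = 0"
      using AE_space by eventually_elim (simp add: \<Phi>_V)
    have AE_f: "AE w in M. \<forall>k\<ge>1. f (x k w) - f xstar = 0"
      using AE_V AE_space by eventually_elim (metis f_le f_nonneg order_antisym)
    show "\<forall>\<eta>\<in>{0<..<1}. AE w in M.
        f (x 0 w) - f xstar \<le> \<Phi> 0 w / \<eta> \<and> (\<forall>k\<ge>1. f (x k w) - f xstar = 0)"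
    proof
      fix \<eta> :: real
      assume \<eta>: "\<eta> \<in> {0<..<1}"
      have f_0: "f (x 0 w) - f xstar \<le> \<Phi> 0 w / \<eta>" if "w \<in> space M" for w
      proof -
        have "V 0 w * \<eta> \<le> V 0 w"
          using \<eta> V_nonneg by (intro mult_left_le) auto
        then have "V 0 w \<le> V 0 w / \<eta>"
          using \<eta> by (simp add: pos_le_divide_eq)
        then show ?thesis
          using f_le[OF that, of 0] \<Phi>_V[OF that] by simp
      qed
      show "AE w in M. f (x 0 w) - f xstar \<le> \<Phi> 0 w / \<eta> \<and> (\<forall>k\<ge>1. f (x k w) - f xstar = 0)"
        using AE_f AE_space by eventually_elim (intro conjI f_0)
    qed
    show "\<forall>q\<in>{0<..<1}. AE w in M. \<forall>k\<ge>1. f (x k w) - f xstar \<le> \<Phi> 0 w * q ^ k"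
    proof
      fix q :: real
      assume "q \<in> {0<..<1}"
      then have q_nonneg: "0 \<le> V 0 w * q ^ k" for w k
        using V_nonneg by simp
      show "AE w in M. \<forall>k\<ge>1. f (x k w) - f xstar \<le> \<Phi> 0 w * q ^ k"
        using AE_f AE_space by eventually_elim (simp add: \<Phi>_V q_nonneg)
    qed
  next
    assume "\<rho> \<in> {0<..<1}"
    then have \<rho>_pos: "0 < \<rho>" "0 \<le> \<rho>"
      by auto
    show "\<forall>\<eta>\<in>{0<..<1}. 1 - \<eta> \<le> \<P>(w in M. \<forall>k. f (x k w) - f xstar \<le> \<Phi> 0 w / \<eta> * \<rho> ^ k)"
    proof
      fix \<eta> :: real
      assume \<eta>: "\<eta> \<in> {0<..<1}"
      have "1 - \<eta> \<le> \<P>(w in M. \<forall>k. V k w \<le> v0 / \<eta> * \<rho> ^ k)"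
        using \<eta> \<rho>_pos by (intro M.geometric_maximal[OF super]) auto
      also have "\<dots> \<le> \<P>(w in M. \<forall>k. f (x k w) - f xstar \<le> v0 / \<eta> * \<rho> ^ k)"
        using f_le by (intro M.finite_measure_mono) (auto intro: order_trans)
      also have "\<dots> = \<P>(w in M. \<forall>k. f (x k w) - f xstar \<le> \<Phi> 0 w / \<eta> * \<rho> ^ k)"
        by (intro arg_cong[where f = "measure M"]) (auto simp: \<Phi>_V V_0)
      finally show "1 - \<eta> \<le> \<dots>" .
    qed
    show "\<forall>q\<in>{\<rho><..<1}. \<exists>K \<in> measurable M (count_space (UNIV :: nat set)).
        AE w in M. \<forall>k\<ge>K w. f (x k w) - f xstar \<le> \<Phi> 0 w * q ^ k"
    proof
      fix q :: real
      assume q: "q \<in> {\<rho><..<1}"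
      \<comment> \<open>The least admissible index is measurable in \<open>w\<close>, being
        determined by countably many measurable conditions. The constant \<open>v0\<close> stands
        for \<open>\<Phi> 0 w\<close>, with which it agrees on \<open>space M\<close>.\<close>
      define K where "K w = (LEAST n. \<forall>k\<ge>n. f (x k w) - f xstar \<le> v0 * q ^ k)" for w
      have "AE w in M. \<exists>n. \<forall>k\<ge>n. V k w \<le> v0 * q ^ k"
        using q \<rho>_pos by (intro M.geometric_eventually[OF super]) auto
      then have "AE w in M. \<forall>k\<ge>K w. f (x k w) - f xstar \<le> \<Phi> 0 w * q ^ k"
        using AE_space
      proof eventually_elim
        case (elim w)
        then have "\<exists>n. \<forall>k\<ge>n. f (x k w) - f xstar \<le> v0 * q ^ k"
          using f_le order_trans by blast
        then have "\<forall>k\<ge>K w. f (x k w) - f xstar \<le> v0 * q ^ k"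
          unfolding K_def by (rule LeastI_ex)
        then show ?case
          using elim by (simp add: \<Phi>_V V_0)
      qed
      moreover have "K \<in> measurable M (count_space UNIV)"
        unfolding K_def by measurable
      ultimately show "\<exists>K \<in> measurable M (count_space (UNIV :: nat set)).
          AE w in M. \<forall>k\<ge>K w. f (x k w) - f xstar \<le> \<Phi> 0 w * q ^ k"
        by blast
    qed
  qed
qed

end
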